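(* Consider the linear control system $\Sigma$: $\dot\xi = A\xi + B\upsilon$, $\zeta = C\xi$, with $A\in\mathbb{R}^{n\times n}$, $B\in\mathbb{R}^{n\times m}$, $C\in\mathbb{R}^{q\times n}$ and $(A,B)$ stabilizable, and the abstraction $\hat\Sigma$: $\dot{\hat\xi} = \hat A\hat\xi + \hat B\hat\upsilon$, $\hat\zeta = \hat C\hat\xi$, with $\hat A\in\mathbb{R}^{\hat n\times\hat n}$, $\hat B\in\mathbb{R}^{\hat n\times\hat m}$, $\hat C\in\mathbb{R}^{q\times\hat n}$. Let $P\in\mathbb{R}^{n\times\hat n}$, $Q\in\mathbb{R}^{m\times\hat n}$, let $R\in\mathbb{R}^{m\times\hat m}$ be chosen to minimize $\|BR-P\hat B\|$, and let $\alpha>0$ be a fixed scalar. Suppose that $U=U^T>0$ and $K\in\mathbb{R}^{m\times n}$ are a solution to Optimization Problem 1 (stated in the context), and that $\hat C = CP$. Then $$V(x,\hat x) := (x-P\hat x)^T U (x-P\hat x)$$ is a practical simulation function from $\hat\Sigma$ to $\Sigma$ with the associated interface $$v(x,\hat x,\hat u) = K(x-P\hat x)+Q\hat x+R\hat u .$$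
   Context: **Classes of functions.** $\mathcal{K}$ is the set of continuous strictly increasing $\alpha:\mathbb{R}_{\ge0}\to\mathbb{R}_{\ge0}$ with $\alpha(0)=0$; $\mathcal{K}_\infty$ is the set of those $\alpha\in\mathcal{K}$ with $\alpha(s)\to\infty$ as $s\to\infty$. $\|\cdot\|$ is the Euclidean norm of vectors and the induced norm of matrices. Inequalities between symmetric matrices are in the semidefinite sense. **Practical simulation function.** A control system $\Sigma=(\mathbb{R}^n,\mathbb{R}^m,f,\mathbb{R}^q,h)$ is $\dot\xi=f(\xi,\upsilon)$, $\zeta=h(\xi)$, with $f:\mathbb{R}^n\times\mathbb{R}^m\to\mathbb{R}^n$ locally Lipschitz and $h:\mathbb{R}^n\to\mathbb{R}^q$. Let $\hat\Sigma=(\mathbb{R}^{\hat n},\mathbb{R}^{\hat m},\hat f,\mathbb{R}^q,\hat h)$ be another control system (the abstraction). A continuously differentiable $V:\mathbb{R}^n\times\mathbb{R}^{\hat n}\to\mathbb{R}_{\ge0}$ is a practical simulation function from $\hat\Sigma$ to $\Sigma$ with associated interface $v:\mathbb{R}^n\times\mathbb{R}^{\hat n}\times\mathbb{R}^{\hat m}\to\mathbb{R}^m$ (a locally Lipschitz function) if there exist $\nu,\eta\in\mathcal{K}_\infty$, $\rho\in\mathcal{K}\cup\{0\}$ and $\Delta:\mathbb{R}^{\hat n}\to\mathbb{R}_{\ge0}$ such that for all $x\in\mathbb{R}^n$, $\hat x\in\mathbb{R}^{\hat n}$, $\hat u\in\mathbb{R}^{\hat m}$: $$\nu(\|h(x)-\hat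 h(\hat x)\|)\le V(x,\hat x),$$ $$\frac{\partial V(x,\hat x)}{\partial x}f(x,v(x,\hat x,\hat u))+\frac{\partial V(x,\hat x)}{\partial\hat x}\hat f(\hat x,\hat u)\le-\eta(V(x,\hat x))+\rho(\|\hat u\|)+\Delta(\hat x).$$ **Optimization Problem 1.** Put $W:=\begin{bmatrix} I & BR-P\hat B\end{bmatrix}$, with $I$ the $n\times n$ identity. For fixed $\alpha>0$: minimize $\beta$ over $Z:=U^{-1}$ (with $U=U^T>0$) and $Y:=KZ$, subject to $Z\le\beta I$ and $$\begin{bmatrix}AZ+ZA^T+Y^TB^T+BY+\alpha Z & W\\ W^T & -\alpha I\end{bmatrix}\le0 .$$ A solution $(Z,Y)$ determines $U=Z^{-1}$ and $K=YZ^{-1}$. *)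

theory Defs
  imports "HOL-Analysis.Analysis"
begin

(* Class K and K-infinity functions live on the nonnegative reals; they are represented by
   functions on all reals whose values at negative arguments are irrelevant. *)
definition class_K :: "(real \<Rightarrow> real) \<Rightarrow> bool" where
  "class_K \<alpha> \<longleftrightarrow> continuous_on {0..} \<alpha> \<and> strict_mono_on {0..} \<alpha> \<and> \<alpha> 0 = 0"

definition class_K_inf :: "(real \<Rightarrow> real) \<Rightarrow> bool" where
  "class_K_inf \<alpha> \<longleftrightarrow> class_K \<alpha> \<and> filterlim \<alpha> at_top at_top"

definition locally_lipschitz :: "('a::metric_space \<Rightarrow> 'b::metric_space) \<Rightarrow> bool" where
  "locally_lipschitz g \<longleftrightarrow> (\<forall>x. \<exists>r>0. \<exists>L. L-lipschitz_on (cball x r) g)"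

definition continuously_differentiable ::
    "('a::real_normed_vector \<Rightarrow> 'b::real_normed_vector) \<Rightarrow> bool" where
  "continuously_differentiable g \<longleftrightarrow>
     (\<exists>g'. (\<forall>x. (g has_derivative blinfun_apply (g' x)) (at x)) \<and> continuous_on UNIV g')"

(* The system  xi' = dyn (xi, upsilon),  zeta = out xi. *)
record ('x, 'u, 'y) control_system =
  dyn :: "'x \<times> 'u \<Rightarrow> 'x"
  out :: "'x \<Rightarrow> 'y"

definition is_control_system :: "(real^'n, real^'m, real^'q) control_system \<Rightarrow> bool" where
  "is_control_system S \<longleftrightarrow> locally_lipschitz (dyn S)"

definition linear_system ::
    "real^'n^'n \<Rightarrow> real^'m^'n \<Rightarrow> real^'n^'q \<Rightarrow> (real^'n, real^'m, real^'q) control_system" where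
  "linear_system A B C = \<lparr> dyn = (\<lambda>(x, u). A *v x + B *v u), out = (\<lambda>x. C *v x) \<rparr>"

(* V is a practical simulation function from Sh (the abstraction) to S with interface v. *)
definition practical_simulation_function ::
    "(real^'h, real^'k, real^'q) control_system \<Rightarrow> (real^'n, real^'m, real^'q) control_system \<Rightarrow>
     ((real^'n) \<times> (real^'h) \<Rightarrow> real) \<Rightarrow> ((real^'n) \<times> (real^'h) \<times> (real^'k) \<Rightarrow> real^'m) \<Rightarrow> bool" where
  "practical_simulation_function Sh S V v \<longleftrightarrow>
     is_control_system Sh \<and> is_control_system S \<and>
     continuously_differentiable V \<and> (\<forall>z. 0 \<le> V z) \<and> locally_lipschitz v \<and>
     (\<exists>\<nu> \<eta> \<rho> \<Delta>.
        class_K_inf \<nu> \<and> class_K_inf \<eta> \<and> (class_K \<rho> \<or> (\<forall>s\<ge>0. \<rho> s = 0)) \<and> (\<forall>xh. 0 \<le> \<Delta> xh) \<and>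
        (\<forall>x xh uh.
           \<nu> (norm (out S x - out Sh xh)) \<le> V (x, xh) \<and>
           frechet_derivative (\<lambda>y. V (y, xh)) (at x) (dyn S (x, v (x, xh, uh)))
             + frechet_derivative (\<lambda>y. V (x, y)) (at xh) (dyn Sh (xh, uh))
           \<le> - \<eta> (V (x, xh)) + \<rho> (norm uh) + \<Delta> xh))"

definition hurwitz :: "real^'n^'n \<Rightarrow> bool" where
  "hurwitz M \<longleftrightarrow>
     (\<forall>(l::complex) w. w \<noteq> 0 \<and> map_matrix complex_of_real M *v w = l *s w \<longrightarrow> Re l < 0)"

definition stabilizable :: "real^'n^'n \<Rightarrow> real^'m^'n \<Rightarrow> bool" where
  "stabilizable A B \<longleftrightarrow> (\<exists>F :: real^'n^'m. hurwitz (A + B ** F))"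

definition pos_def :: "real^'n^'n \<Rightarrow> bool" where
  "pos_def M \<longleftrightarrow> transpose M = M \<and> (\<forall>x. x \<noteq> 0 \<longrightarrow> 0 < x \<bullet> (M *v x))"

definition pos_semidef :: "real^'n^'n \<Rightarrow> bool" where
  "pos_semidef M \<longleftrightarrow> transpose M = M \<and> (\<forall>x. 0 \<le> x \<bullet> (M *v x))"

definition loewner_le :: "real^'n^'n \<Rightarrow> real^'n^'n \<Rightarrow> bool" (infix "\<preceq>" 50) where
  "M \<preceq> N \<longleftrightarrow> pos_semidef (N - M)"

(* In real^'c^'r the row index type is 'r and the column index type is 'c; the blocks of a
   partitioned matrix are indexed by sum types. *)
definition hcat :: "'a^'c^'r \<Rightarrow> 'a^'d^'r \<Rightarrow> 'a^('c + 'd)^'r" where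
  "hcat M N = (\<chi> i j. case j of Inl a \<Rightarrow> M $ i $ a | Inr b \<Rightarrow> N $ i $ b)"

definition vcat :: "'a^'c^'r \<Rightarrow> 'a^'c^'s \<Rightarrow> 'a^'c^('r + 's)" where
  "vcat M N = (\<chi> i. case i of Inl a \<Rightarrow> M $ a | Inr b \<Rightarrow> N $ b)"

definition opt1_W ::
    "real^'m^'n \<Rightarrow> real^'k^'m \<Rightarrow> real^'h^'n \<Rightarrow> real^'k^'h \<Rightarrow> real^('n + 'k)^'n" where
  "opt1_W B R P Bh = hcat (mat 1) (B ** R - P ** Bh)"

definition opt1_feasible ::
    "real^'n^'n \<Rightarrow> real^'m^'n \<Rightarrow> real^'w^'n \<Rightarrow> real \<Rightarrow> real \<times> (real^'n^'n) \<times> (real^'n^'m) \<Rightarrow> bool" where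
  "opt1_feasible A B W \<alpha> = (\<lambda>(\<beta>, Z, Y).
     (\<exists>U. pos_def U \<and> Z = matrix_inv U) \<and>
     Z \<preceq> \<beta> *\<^sub>R mat 1 \<and>
     vcat (hcat (A ** Z + Z ** transpose A + transpose Y ** transpose B + B ** Y + \<alpha> *\<^sub>R Z) W)
          (hcat (transpose W) (- (\<alpha> *\<^sub>R mat 1))) \<preceq> 0)"

(* U and K are read off from a minimizer; the substitution Y = K Z is a bijective change of
   variables, so Y ranges over all matrices. *)
definition opt1_solution ::
    "real^'n^'n \<Rightarrow> real^'m^'n \<Rightarrow> real^'w^'n \<Rightarrow> real \<Rightarrow> real^'n^'n \<Rightarrow> real^'n^'m \<Rightarrow> bool" where
  "opt1_solution A B W \<alpha> U K \<longleftrightarrow>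
     (\<exists>\<beta> Z Y. is_arg_min fst (opt1_feasible A B W \<alpha>) (\<beta>, Z, Y) \<and>
              U = matrix_inv Z \<and> K = Y ** matrix_inv Z)"

end

theory Submission
  imports Defs
begin

text \<open>
  Write \<open>e = x - P *v xh\<close> for the error, so that the simulation function is \<open>V = e \<bullet> (U *v e)\<close>.
  Under the interface the error obeys \<open>e' = (A + B K) e + D xh + (B R - P Bh) uh\<close> with
  \<open>D = A P + B Q - P Ah\<close>, and the last two terms together are \<open>W w\<close> for the stacked disturbance
  \<open>w = (D xh, uh)\<close>; this is why the first block of \<open>W\<close> is the identity. The matrix inequality of the
  optimization problem, tested against the vector \<open>(U e, w)\<close>, yields
  \[ V' \le - \alpha V + \alpha |w|^2 = - \alpha V + \alpha |uh|^2 + \alpha |D xh|^2 , \]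
  see \<open>opt1_dissipation\<close>. Hence one may take \<open>\<eta> s = \<alpha> s\<close>, \<open>\<rho> s = \<alpha> s\<^sup>2\<close> and \<open>\<Delta> xh = \<alpha> |D xh|\<^sup>2\<close>.

  The output bound comes from the other constraint. As \<open>Ch = C P\<close>, the output mismatch is \<open>C e\<close>, and
  \<open>Z \<preceq> \<beta> I\<close> with \<open>Z\<close> the inverse of \<open>U\<close> means \<open>|e|\<^sup>2 \<le> \<beta> V\<close>, see \<open>norm_le_of_inverse_bounded\<close>. With
  \<open>|C e| \<le> c |e|\<close> this gives \<open>\<nu> s = s\<^sup>2 / (c\<^sup>2 \<beta>)\<close>.
\<close>

section \<open>Quadratic forms of block matrices\<close>

definition vjoin :: "'a^'r \<Rightarrow> 'a^'s \<Rightarrow> 'a^('r + 's)" where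
  "vjoin x y = (\<chi> i. case i of Inl a \<Rightarrow> x $ a | Inr b \<Rightarrow> y $ b)"

lemma sum_UNIV_sum_type:
  fixes g :: "'r::finite + 's::finite \<Rightarrow> 'b::comm_monoid_add"
  shows "(\<Sum>i\<in>UNIV. g i) = (\<Sum>a\<in>UNIV. g (Inl a)) + (\<Sum>b\<in>UNIV. g (Inr b))"
  by (simp add: UNIV_Plus_UNIV[symmetric] sum.Plus del: UNIV_Plus_UNIV)

lemma hcat_mult_vjoin:
  fixes M :: "real^'c^'r" and N :: "real^'d^'r"
  shows "hcat M N *v vjoin x y = M *v x + N *v y"
  by (simp add: vec_eq_iff matrix_vector_mult_def hcat_def vjoin_def sum_UNIV_sum_type)

lemma vcat_mult:
  fixes M :: "real^'c^'r" and N :: "real^'c^'s"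
  shows "vcat M N *v u = vjoin (M *v u) (N *v u)"
  by (auto simp: vec_eq_iff matrix_vector_mult_def vcat_def vjoin_def split: sum.splits)

lemma inner_vjoin:
  fixes a c :: "real^'r" and b d :: "real^'s"
  shows "vjoin a b \<bullet> vjoin c d = a \<bullet> c + b \<bullet> d"
  by (simp add: inner_vec_def vjoin_def sum_UNIV_sum_type)

lemma inner_transpose_mult:
  fixes M :: "real^'c^'r"
  shows "x \<bullet> (transpose M *v y) = (M *v x) \<bullet> y"
  by (metis dot_lmul_matrix inner_commute transpose_matrix_vector)

lemma quadratic_form_symmetric_block:
  fixes M :: "real^'n^'n" and W :: "real^'w^'n" and N :: "real^'w^'w"
  shows "vjoin z w \<bullet> (vcat (hcat M W) (hcat (transpose W) N) *v vjoin z w)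
       = z \<bullet> (M *v z) + 2 * (z \<bullet> (W *v w)) + w \<bullet> (N *v w)"
  by (simp add: vcat_mult hcat_mult_vjoin inner_vjoin inner_transpose_mult inner_add_right
      inner_commute[of "W *v w"] del: transpose_matrix_vector)

section \<open>Consequences of feasibility\<close>

lemma matrix_uminus_vector_mult:
  fixes M :: "real^'c^'r"
  shows "(- M) *v x = - (M *v x)"
  using matrix_vector_mult_diff_rdistrib[of 0 M x] by simp

lemma matrix_inv_inverse:
  assumes "invertible M"
  shows "M ** matrix_inv M = mat 1" and "matrix_inv M ** M = mat 1"
  using assms unfolding invertible_def matrix_inv_def by (metis (mono_tags, lifting) someI_ex)+

lemma pos_def_invertible:
  assumes "pos_def M"
  shows "invertible M"
proof -
  have "x = 0" if "M *v x = 0" for x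
    using assms that by (metis inner_zero_right less_irrefl pos_def_def)
  then show ?thesis
    using matrix_left_invertible_ker[of M] by (auto simp: invertible_left_inverse)
qed

lemma pos_def_inner_mult:
  assumes "pos_def M"
  shows "(M *v x) \<bullet> y = x \<bullet> (M *v y)"
  by (metis assms inner_transpose_mult pos_def_def)

lemma pos_def_quadratic_nonneg:
  assumes "pos_def M"
  shows "0 \<le> x \<bullet> (M *v x)"
  using assms by (cases "x = 0") (auto simp: pos_def_def less_imp_le)

text \<open>
  The problem is posed in \<open>Z\<close> and \<open>Y\<close>, from which \<open>U\<close> and \<open>K\<close> are recovered by inversion. Going back
  requires that \<open>Z\<close>, itself the inverse of some positive definite matrix, determines that matrix,
  which is therefore \<open>U\<close>; then \<open>Y\<close> is \<open>K Z\<close>.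
\<close>

lemma opt1_solutionE:
  assumes "opt1_solution A B W \<alpha> U K"
  obtains \<beta> Z where "opt1_feasible A B W \<alpha> (\<beta>, Z, K ** Z)" "pos_def U" "U ** Z = mat 1" "Z ** U = mat 1"
proof -
  obtain \<beta> Z Y where feas: "opt1_feasible A B W \<alpha> (\<beta>, Z, Y)"
    and U: "U = matrix_inv Z" and K: "K = Y ** matrix_inv Z"
    using assms by (auto simp: opt1_solution_def is_arg_min_def)
  from feas obtain U' where U': "pos_def U'" "Z = matrix_inv U'"
    by (auto simp: opt1_feasible_def)
  have inv': "U' ** Z = mat 1" "Z ** U' = mat 1"
    using matrix_inv_inverse[OF pos_def_invertible[OF U'(1)]] U'(2) by auto
  then have "invertible Z"
    by (auto simp: invertible_def)
  from matrix_inv_inverse[OF this] have inv: "U ** Z = mat 1" "Z ** U = mat 1"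
    by (simp_all add: U)
  have "U = U'"
    by (metis inv(1) inv'(2) matrix_mul_assoc matrix_mul_lid matrix_mul_rid)
  moreover have "K ** Z = Y"
    using K U inv(1) by (metis matrix_mul_assoc matrix_mul_rid)
  ultimately show thesis
    using that feas U'(1) inv by blast
qed

text \<open>
  Inversion reverses the order of positive definite matrices, so \<open>Z \<preceq> \<beta> I\<close> becomes
  \<open>U \<succeq> \<beta>\<inverse> I\<close>. Eigenvalues can be avoided: with \<open>z = U e\<close>, the form of \<open>Z\<close> is nonnegative at
  \<open>e - \<beta> z\<close>, and expanding it gives \<open>0 \<le> e \<bullet> Z e - 2 \<beta> |e|\<^sup>2 + \<beta>\<^sup>2 V\<close> with \<open>V = e \<bullet> U e\<close>.
\<close>

lemma norm_le_of_inverse_bounded: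
  fixes U Z :: "real^'n^'n"
  assumes U: "pos_def U" and UZ: "U ** Z = mat 1" and ZU: "Z ** U = mat 1"
    and Z: "Z \<preceq> \<beta> *\<^sub>R mat 1"
  shows "0 < \<beta>" and "(norm e)\<^sup>2 \<le> \<beta> * (e \<bullet> (U *v e))"
proof -
  have UZv: "U *v (Z *v x) = x" and ZUv: "Z *v (U *v x) = x" for x
    using UZ ZU by (simp_all add: matrix_vector_mul_assoc)
  have Zform: "x \<bullet> (Z *v x) = (Z *v x) \<bullet> (U *v (Z *v x))" for x
    by (simp add: UZv inner_commute)
  have Zle: "x \<bullet> (Z *v x) \<le> \<beta> * (x \<bullet> x)" for x
    using Z by (simp add: loewner_le_def pos_semidef_def matrix_vector_mult_diff_rdistrib
        inner_diff_right flip: scaleR_matrix_vector_assoc)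
  \<comment> \<open>Testing the bound on any unit vector shows that \<open>\<beta>\<close> is positive.\<close>
  define i :: "real^'n" where "i = axis undefined 1"
  have "i \<bullet> i = 1" by (simp add: i_def inner_axis_axis)
  moreover have "Z *v i \<noteq> 0"
    using UZv[of i] \<open>i \<bullet> i = 1\<close> by auto
  then have "0 < i \<bullet> (Z *v i)"
    using U by (simp add: Zform pos_def_def)
  ultimately show pos: "0 < \<beta>"
    using Zle[of i] by simp
  define z where "z = U *v e"
  have "0 \<le> (e - \<beta> *\<^sub>R z) \<bullet> (Z *v (e - \<beta> *\<^sub>R z))"
    unfolding Zform by (rule pos_def_quadratic_nonneg[OF U])
  also have "\<dots> = e \<bullet> (Z *v e) - 2 * \<beta> * (e \<bullet> e) + \<beta> * (\<beta> * (e \<bullet> z))"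
  proof -
    have "Z *v z = e" "z \<bullet> (Z *v e) = e \<bullet> e"
      by (simp_all add: z_def ZUv UZv pos_def_inner_mult[OF U])
    then show ?thesis
      by (simp add: matrix_vector_mult_diff_distrib matrix_vector_mult_scaleR inner_diff_left
          inner_diff_right inner_commute[of z e] algebra_simps)
  qed
  finally have "\<beta> * (e \<bullet> e) \<le> \<beta> * (\<beta> * (e \<bullet> z))"
    using Zle[of e] by simp
  then show "(norm e)\<^sup>2 \<le> \<beta> * (e \<bullet> (U *v e))"
    using pos by (simp add: z_def power2_norm_eq_inner)
qed

text \<open>
  The matrix inequality lives in the coordinate \<open>z = U e\<close>, the one in which the unknowns \<open>Z\<close> and
  \<open>Y = K Z\<close> enter linearly. Since \<open>Z z = e\<close>, its terms \<open>A Z\<close> and \<open>B Y\<close> applied to \<open>z\<close> become \<open>A e\<close> and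
  \<open>B K e\<close>. The left side of the conclusion is the derivative of \<open>V = e \<bullet> U e\<close> along
  \<open>e' = (A + B K) e + W w\<close>.
\<close>

lemma opt1_dissipation:
  fixes A :: "real^'n^'n" and B :: "real^'m^'n" and W :: "real^'w^'n"
  assumes feas: "opt1_feasible A B W \<alpha> (\<beta>, Z, K ** Z)"
    and U: "pos_def U" and ZU: "Z ** U = mat 1"
  shows "2 * ((U *v e) \<bullet> (A *v e + B *v (K *v e) + W *v w))
       \<le> - \<alpha> * (e \<bullet> (U *v e)) + \<alpha> * (norm w)\<^sup>2"
proof -
  define z where "z = U *v e"
  have Zz: "Z *v z = e"
    using ZU by (simp add: z_def matrix_vector_mul_assoc)
  have Zt: "transpose Z = Z"
  proof -
    have "transpose U ** transpose Z = mat 1"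
      using ZU by (metis matrix_transpose_mul transpose_mat)
    then have "U ** transpose Z = mat 1" using U by (simp add: pos_def_def)
    then show ?thesis
      by (metis ZU matrix_mul_assoc matrix_mul_lid matrix_mul_rid)
  qed
  let ?M = "A ** Z + Z ** transpose A + transpose (K ** Z) ** transpose B + B ** (K ** Z) + \<alpha> *\<^sub>R Z"
  have "vjoin z w \<bullet> (vcat (hcat ?M W) (hcat (transpose W) (- (\<alpha> *\<^sub>R mat 1))) *v vjoin z w) \<le> 0"
    using feas by (simp add: opt1_feasible_def loewner_le_def pos_semidef_def matrix_uminus_vector_mult)
  then have "z \<bullet> (?M *v z) + 2 * (z \<bullet> (W *v w)) - \<alpha> * (norm w)\<^sup>2 \<le> 0"
    by (simp add: quadratic_form_symmetric_block power2_norm_eq_inner matrix_uminus_vector_mult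
        flip: scaleR_matrix_vector_assoc)
  moreover have "z \<bullet> (?M *v z) = 2 * (z \<bullet> (A *v e + B *v (K *v e))) + \<alpha> * (e \<bullet> z)"
  proof -
    have "z \<bullet> (A ** Z *v z) = z \<bullet> (A *v e)" "z \<bullet> (B ** (K ** Z) *v z) = z \<bullet> (B *v (K *v e))"
      by (simp_all add: Zz flip: matrix_vector_mul_assoc)
    moreover have "z \<bullet> (Z ** transpose A *v z) = z \<bullet> (A *v e)"
      by (metis Zt Zz inner_commute inner_transpose_mult matrix_vector_mul_assoc)
    moreover have "z \<bullet> (transpose (K ** Z) ** transpose B *v z) = z \<bullet> (B *v (K *v e))"
      by (metis Zz inner_commute inner_transpose_mult matrix_transpose_mul matrix_vector_mul_assoc)
    ultimately show ?thesis
      by (simp add: matrix_vector_mult_add_rdistrib inner_add_right Zz inner_commute[of z e]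
          flip: scaleR_matrix_vector_assoc)
  qed
  ultimately show ?thesis
    by (simp add: z_def inner_add_right algebra_simps)
qed

section \<open>Regularity\<close>

lemma bounded_linear_imp_locally_lipschitz:
  assumes "bounded_linear f"
  shows "locally_lipschitz f"
proof -
  interpret bounded_linear f by fact
  obtain L where L: "L \<ge> 0" "\<And>x. norm (f x) \<le> norm x * L"
    using nonneg_bounded by blast
  have "L-lipschitz_on S f" for S
    by (rule lipschitz_onI) (use L in \<open>auto simp: dist_norm diff[symmetric] mult.commute\<close>)
  then show ?thesis
    unfolding locally_lipschitz_def using zero_less_one by blast
qed

lemma linear_system_is_control_system: "is_control_system (linear_system A B C)"
proof -
  have "bounded_linear (\<lambda>p. A *v fst p + B *v snd p)"
    by (intro bounded_linear_add bounded_linear_compose[OF matrix_vector_mul_bounded_linear]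
        bounded_linear_fst bounded_linear_snd)
  then show ?thesis
    unfolding is_control_system_def linear_system_def
    by (auto simp: case_prod_beta' dest: bounded_linear_imp_locally_lipschitz)
qed

lemma has_derivative_quadratic_form:
  fixes U :: "real^'n^'n"
  assumes U: "pos_def U" and g: "(g has_derivative g') (at x)"
  shows "((\<lambda>y. g y \<bullet> (U *v g y)) has_derivative (\<lambda>d. 2 * ((U *v g x) \<bullet> g' d))) (at x)"
proof -
  have "((\<lambda>y. g y \<bullet> (U *v g y)) has_derivative (\<lambda>d. g x \<bullet> (U *v g' d) + g' d \<bullet> (U *v g x))) (at x)"
    by (intro has_derivative_inner g
        bounded_linear.has_derivative[OF matrix_vector_mul_bounded_linear])
  then show ?thesis
    by (rule has_derivative_eq_rhs)
      (simp add: fun_eq_iff pos_def_inner_mult[OF U] inner_commute[of "g' _"])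
qed

text \<open>
  The gradient of a quadratic form depends linearly on the base point, hence continuously also with
  respect to the operator norm.
\<close>

lemma continuously_differentiable_quadratic_form:
  fixes U :: "real^'n^'n" and L :: "'a::real_normed_vector \<Rightarrow> real^'n"
  assumes U: "pos_def U" and L: "bounded_linear L"
  shows "continuously_differentiable (\<lambda>z. L z \<bullet> (U *v L z))"
  unfolding continuously_differentiable_def
proof (intro exI conjI allI)
  let ?g = "\<lambda>z. blinfun_inner_right (2 *\<^sub>R (U *v L z)) o\<^sub>L Blinfun L"
  show "((\<lambda>z. L z \<bullet> (U *v L z)) has_derivative blinfun_apply (?g z)) (at z)" for z
    by (rule has_derivative_eq_rhs[OF has_derivative_quadratic_form[OF U
          bounded_linear_imp_has_derivative[OF L]]])
      (simp add: fun_eq_iff bounded_linear_Blinfun_apply[OF L])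
  show "continuous_on UNIV ?g"
    by (intro continuous_intros linear_continuous_on L
        bounded_linear_compose[OF bounded_linear_blinfun_inner_right]
        bounded_linear_compose[OF bounded_linear_scaleR_right]
        bounded_linear_compose[OF matrix_vector_mul_bounded_linear])
qed

lemma class_K_inf_scaled_power:
  assumes "c > 0" "n > 0"
  shows "class_K_inf (\<lambda>s. c * s ^ n)"
  unfolding class_K_inf_def class_K_def
proof (intro conjI)
  show "strict_mono_on {0..} (\<lambda>s. c * s ^ n)"
    using assms by (auto intro!: strict_mono_onI power_strict_mono)
  show "filterlim (\<lambda>s. c * s ^ n) at_top at_top"
    using assms by (intro filterlim_tendsto_pos_mult_at_top[OF tendsto_const] filterlim_pow_at_top
        filterlim_ident)
qed (use assms in \<open>auto intro!: continuous_intros\<close>)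

section \<open>The simulation function\<close>

theorem theorem2:
  fixes A :: "real^'n^'n" and B :: "real^'m^'n" and C :: "real^'n^'q"
    and Ah :: "real^'h^'h" and Bh :: "real^'k^'h" and Ch :: "real^'h^'q"
    and P :: "real^'h^'n" and Q :: "real^'h^'m" and R :: "real^'k^'m"
    and U :: "real^'n^'n" and K :: "real^'n^'m" and \<alpha> :: real
  assumes "stabilizable A B"
    and "is_arg_min (\<lambda>R'. onorm ((*v) (B ** R' - P ** Bh))) (\<lambda>_. True) R"
    and "\<alpha> > 0"
    and "pos_def U"
    and "opt1_solution A B (opt1_W B R P Bh) \<alpha> U K"
    and "Ch = C ** P"
  shows "practical_simulation_function (linear_system Ah Bh Ch) (linear_system A B C)
           (\<lambda>(x, xh). (x - P *v xh) \<bullet> (U *v (x - P *v xh)))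
           (\<lambda>(x, xh, uh). K *v (x - P *v xh) + Q *v xh + R *v uh)"
proof -
  obtain \<beta> Z where feas: "opt1_feasible A B (opt1_W B R P Bh) \<alpha> (\<beta>, Z, K ** Z)"
    and UZ: "U ** Z = mat 1" and ZU: "Z ** U = mat 1"
    using opt1_solutionE[OF assms(5)] by metis
  note U = \<open>pos_def U\<close>
  have Z: "Z \<preceq> \<beta> *\<^sub>R mat 1"
    using feas by (simp add: opt1_feasible_def)
  note \<beta> = norm_le_of_inverse_bounded[OF U UZ ZU Z]
  obtain c where c: "c > 0" "\<And>e. norm (C *v e) \<le> norm e * c"
    using bounded_linear.pos_bounded[OF matrix_vector_mul_bounded_linear[of C]] by blast
  define D where "D = A ** P + B ** Q - P ** Ah"
  let ?V = "\<lambda>x xh. (x - P *v xh) \<bullet> (U *v (x - P *v xh))"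
  \<comment> \<open>The constant \<open>c\<close> is a positive bound of the operator norm of \<open>C\<close>, so that division by \<open>c\<^sup>2\<close> makes
    sense also for \<open>C = 0\<close>.\<close>
  have out_bound: "1 / (c\<^sup>2 * \<beta>) * (norm (C *v x - Ch *v xh))\<^sup>2 \<le> ?V x xh" for x xh
  proof -
    let ?e = "x - P *v xh"
    have "C *v x - Ch *v xh = C *v ?e"
      by (simp add: \<open>Ch = C ** P\<close> matrix_vector_mult_diff_distrib matrix_vector_mul_assoc)
    then have "(norm (C *v x - Ch *v xh))\<^sup>2 \<le> (norm ?e * c)\<^sup>2"
      using c by (simp add: power_mono)
    also have "\<dots> \<le> c\<^sup>2 * (\<beta> * ?V x xh)"
      using \<beta>(2)[of ?e] c(1) by (simp add: power_mult_distrib mult.commute)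
    finally show ?thesis
      using c(1) \<beta>(1) by (simp add: divide_le_eq mult_ac)
  qed
  have decay:
    "frechet_derivative (\<lambda>y. ?V y xh) (at x) (A *v x + B *v (K *v (x - P *v xh) + Q *v xh + R *v uh))
       + frechet_derivative (\<lambda>y. ?V x y) (at xh) (Ah *v xh + Bh *v uh)
     \<le> - (\<alpha> * ?V x xh ^ 1) + \<alpha> * (norm uh)\<^sup>2 + \<alpha> * (norm (D *v xh))\<^sup>2"
    for x xh uh
  proof -
    let ?dx = "frechet_derivative (\<lambda>y. ?V y xh) (at x)" and ?dxh = "frechet_derivative (?V x) (at xh)"
    let ?f = "A *v x + B *v (K *v (x - P *v xh) + Q *v xh + R *v uh)" and ?fh = "Ah *v xh + Bh *v uh"
    let ?e = "x - P *v xh" and ?w = "vjoin (D *v xh) uh"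
    have "((\<lambda>y. y - P *v xh) has_derivative (\<lambda>d. d)) (at x)"
      by (auto intro!: derivative_eq_intros)
    then have dx: "?dx d = 2 * ((U *v ?e) \<bullet> d)" for d
      by (simp flip: frechet_derivative_at[OF has_derivative_quadratic_form[OF U]])
    have "((\<lambda>y. x - P *v y) has_derivative (\<lambda>d. - (P *v d))) (at xh)"
      by (auto intro!: derivative_eq_intros
          bounded_linear_imp_has_derivative matrix_vector_mul_bounded_linear)
    then have dxh: "?dxh d = 2 * ((U *v ?e) \<bullet> - (P *v d))" for d
      by (simp flip: frechet_derivative_at[OF has_derivative_quadratic_form[OF U]])
    \<comment> \<open>The error dynamics: \<open>A x\<close> splits as \<open>A e + A P xh\<close>, and the second summand is absorbed by \<open>D\<close>.\<close>
    have "?f - P *v ?fh = A *v ?e + B *v (K *v ?e) + opt1_W B R P Bh *v ?w"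
      by (simp add: opt1_W_def hcat_mult_vjoin D_def matrix_vector_mult_diff_distrib
          matrix_vector_right_distrib matrix_vector_mult_diff_rdistrib matrix_vector_mult_add_rdistrib
          flip: matrix_vector_mul_assoc)
    then have "?dx ?f + ?dxh ?fh = 2 * ((U *v ?e) \<bullet> (A *v ?e + B *v (K *v ?e) + opt1_W B R P Bh *v ?w))"
      by (simp add: dx dxh inner_diff_right flip: \<open>?f - P *v ?fh = _\<close>)
    also have "\<dots> \<le> - \<alpha> * ?V x xh + \<alpha> * (norm ?w)\<^sup>2"
      by (rule opt1_dissipation[OF feas U ZU])
    also have "(norm ?w)\<^sup>2 = (norm (D *v xh))\<^sup>2 + (norm uh)\<^sup>2"
      by (simp add: power2_norm_eq_inner inner_vjoin)
    finally show ?thesis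
      by (simp add: algebra_simps)
  qed
  have lin: "bounded_linear (\<lambda>p. fst p - P *v snd p)"
    by (intro bounded_linear_sub bounded_linear_compose[OF matrix_vector_mul_bounded_linear]
        bounded_linear_fst bounded_linear_snd)
  have "continuously_differentiable (\<lambda>(x, xh). ?V x xh)"
    using continuously_differentiable_quadratic_form[OF U lin] by (simp add: case_prod_beta')
  moreover have "locally_lipschitz (\<lambda>(x, xh, uh). K *v (x - P *v xh) + Q *v xh + R *v uh)"
    unfolding case_prod_beta'
    by (intro bounded_linear_imp_locally_lipschitz bounded_linear_add bounded_linear_sub
        bounded_linear_compose[OF matrix_vector_mul_bounded_linear]
        bounded_linear_compose[OF bounded_linear_fst] bounded_linear_compose[OF bounded_linear_snd]
        bounded_linear_fst bounded_linear_snd)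
  \<comment> \<open>The exponent 1 in the decay rate lets all three gains be instances of one power law.\<close>
  moreover have "class_K_inf (\<lambda>s. 1 / (c\<^sup>2 * \<beta>) * s\<^sup>2)" "class_K_inf (\<lambda>s. \<alpha> * s ^ 1)"
    "class_K_inf (\<lambda>s. \<alpha> * s\<^sup>2)"
    by (rule class_K_inf_scaled_power; use c(1) \<beta>(1) \<open>\<alpha> > 0\<close> in simp)+
  ultimately show ?thesis
    unfolding practical_simulation_function_def
  proof (intro conjI exI allI)
    show "is_control_system (linear_system Ah Bh Ch)" "is_control_system (linear_system A B C)"
      by (rule linear_system_is_control_system)+
    show "class_K_inf (\<lambda>s. 1 / (c\<^sup>2 * \<beta>) * s\<^sup>2)" "class_K_inf (\<lambda>s. \<alpha> * s ^ 1)"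
      by fact+
    show "class_K (\<lambda>s. \<alpha> * s\<^sup>2) \<or> (\<forall>s\<ge>0. \<alpha> * s\<^sup>2 = 0)"
      using \<open>class_K_inf (\<lambda>s. \<alpha> * s\<^sup>2)\<close> by (simp add: class_K_inf_def)
    show "0 \<le> \<alpha> * (norm (D *v xh))\<^sup>2" for xh
      using \<open>\<alpha> > 0\<close> by simp
  qed (use out_bound decay pos_def_quadratic_nonneg[OF U]
      in \<open>simp_all add: linear_system_def split_beta\<close>)
qed

end
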